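(* Let $\alpha,\beta\ge0$ be integers. For $l=1,2$ let $\psi^l$ be a relative $(\max,+)$-function of $\alpha+2$ variables and $\phi^l$ a relative $(\max,+)$-function of $\beta+2$ variables, with corresponding relatively elementary functions $f^l_t$, $g^l_t$. Assume that $f^1_t$ and $f^2_t$ are tropically equivalent and that $g^1_t$ and $g^2_t$ are tropically equivalent. Let $c$ be the maximum of the Lipschitz constants and $M$ the maximum of the numbers of components of $\psi^1,\psi^2,\phi^1,\phi^2$. Let $t>1$ and, for $l=1,2$, let $\{z_i(l)\}_{i\ge0}$, $\{w^j(l)\}_{j\ge0}$ be sequences of positive numbers, and let $(z_i^j(l),w_i^j(l))_{i,j\ge 0}$ be the solution of $$z_i^{j+1}(l)=f^l_t(w_i^j(l),z_i^j(l),\dots,z_{i+\alpha}^j(l)),\qquad w_{i+1}^j(l)=g^l_t(w_i^j(l),z_i^j(l),\dots,z_{i+\beta}^j(l))$$ with $z_i^0(l)=z_i(l)$, $w_0^j(l)=w^j(l)$. Then for all $i,j\ge0$ $$\max\Big(\frac{z_i^{j+1}(1)}{z_i^{j+1}(2)},\frac{z_i^{j+1}(2)}{z_i^{j+1}(1)},\frac{w_{i+1}^j(1)}{w_{i+1}^j(2)},\frac{w_{i+1}^j(2)}{w_{i+1}^j(1)}\Big)\le M^{2P_{i+j(\gamma+1)}(c)}\,\Lambda^{\tilde c^{\,i+1+j(\gamma+1)}},$$ where $\gamma=\max(\alpha,\beta)$, $\tilde c=\max(c,1)$ and $$\Lambda=\sup_{i,j}\max\Big(\frac{z_i(1)}{z_i(2)},\frac{z_i(2)}{z_i(1)},\frac{w^j(1)}{w^j(2)},\frac{w^j(2)}{w^j(1)}\Big)\in[1,\infty].$$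 In particular the constants $M\ge1$ and $c\ge0$ do not depend on the initial values.
   Context: A relative $(\max,+)$-function of $n$ variables is a function $\varphi:\mathbb R^n\to\mathbb R$ together with a presentation $\varphi(\bar x)=\max(\alpha_1+\bar a_1\cdot\bar x,\dots,\alpha_m+\bar a_m\cdot\bar x)-\max(\beta_1+\bar b_1\cdot\bar x,\dots,\beta_l+\bar b_l\cdot\bar x)$, with $\alpha_k,\beta_k\in\mathbb R$, $\bar a_k,\bar b_k\in\mathbb Q^n$. Its number of components is the product $ml$. $\mathbb R^n$ carries the metric of the norm $|\bar x|=\max_i|x_i|$, and Lipschitz constants are with respect to it. For $t>1$ the corresponding relatively elementary function is $f_t:(0,\infty)^n\to(0,\infty)$, $f_t(\bar z)=\dfrac{\sum_{k=1}^m t^{\alpha_k}\bar z^{\bar a_k}}{\sum_{k=1}^l t^{\beta_k}\bar z^{\bar b_k}}$, where $\bar z^{\bar a}=\prod_i z_i^{a^i}$. Two relatively elementary functions are tropically equivalent if the corresponding $(\max,+)$-functions are equal as functions on $\mathbb R^n$ (their presentations may differ). $P_k(c)=\frac{c^{k+1}-1}{c-1}=1+c+\dots+c^k$ (so $P_k(1)=k+1$). *)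

theory Defs
  imports "Jordan_Normal_Form.Matrix" "HOL-Library.Extended_Real"
begin

text \<open>Vectors of \<open>\<real>\<^sup>n\<close> are the members of \<open>carrier_vec n\<close>. A relative (max,+)-function is
  represented by its presentation: the entries \<open>(\<alpha>\<^sub>k, a\<^sub>k)\<close> of the first maximum and the entries
  \<open>(\<beta>\<^sub>k, b\<^sub>k)\<close> of the second one. They are lists, not sets, because repeated entries count for the
  number of components and for the associated relatively elementary function.\<close>

datatype maxplus_pres =
  MaxplusPres (pos_terms: "(real \<times> rat vec) list") (neg_terms: "(real \<times> rat vec) list")

definition relative_maxplus :: "nat \<Rightarrow> maxplus_pres \<Rightarrow> bool" where
  "relative_maxplus n p \<longleftrightarrow>
     pos_terms p \<noteq> [] \<and> neg_terms p \<noteq> [] \<and>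
     (\<forall>(\<alpha>, a) \<in> set (pos_terms p) \<union> set (neg_terms p). a \<in> carrier_vec n)"

definition components :: "maxplus_pres \<Rightarrow> nat" where
  "components p = length (pos_terms p) * length (neg_terms p)"

definition affine_term :: "real \<times> rat vec \<Rightarrow> real vec \<Rightarrow> real" where
  "affine_term = (\<lambda>(\<alpha>, a) x. \<alpha> + map_vec real_of_rat a \<bullet> x)"

definition maxplus_fun :: "maxplus_pres \<Rightarrow> real vec \<Rightarrow> real" where
  "maxplus_fun p x =
     (MAX s \<in> set (pos_terms p). affine_term s x) - (MAX s \<in> set (neg_terms p). affine_term s x)"

definition elementary_term :: "real \<Rightarrow> real \<times> rat vec \<Rightarrow> real vec \<Rightarrow> real" where
  "elementary_term t =
     (\<lambda>(\<alpha>, a) z. t powr \<alpha> * (\<Prod>i<dim_vec z. (z $ i) powr real_of_rat (a $ i)))"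

definition elementary_fun :: "real \<Rightarrow> maxplus_pres \<Rightarrow> real vec \<Rightarrow> real" where
  "elementary_fun t p z =
     (\<Sum>s \<leftarrow> pos_terms p. elementary_term t s z) / (\<Sum>s \<leftarrow> neg_terms p. elementary_term t s z)"

definition tropically_equivalent :: "nat \<Rightarrow> maxplus_pres \<Rightarrow> maxplus_pres \<Rightarrow> bool" where
  "tropically_equivalent n p q \<longleftrightarrow> (\<forall>x \<in> carrier_vec n. maxplus_fun p x = maxplus_fun q x)"

text \<open>The maximum is only meaningful for vectors of positive dimension.\<close>

definition max_norm :: "real vec \<Rightarrow> real" where
  "max_norm x = (MAX i \<in> {..<dim_vec x}. \<bar>x $ i\<bar>)"

text \<open>The Lipschitz constant of a function on \<open>\<real>\<^sup>n\<close> is its least one, for the maximum norm.\<close>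

definition lipschitz_constant :: "nat \<Rightarrow> (real vec \<Rightarrow> real) \<Rightarrow> real" where
  "lipschitz_constant n F =
     Inf {L. 0 \<le> L \<and> (\<forall>x \<in> carrier_vec n. \<forall>y \<in> carrier_vec n. \<bar>F x - F y\<bar> \<le> L * max_norm (x - y))}"

definition P :: "nat \<Rightarrow> real \<Rightarrow> real" where
  "P k c = (\<Sum>i\<le>k. c ^ i)"

lemma P_eq_quotient: "c \<noteq> 1 \<Longrightarrow> P k c = (c ^ (k + 1) - 1) / (c - 1)"
  using geometric_sum[of c "Suc k"] by (simp add: P_def lessThan_Suc_atMost)

text \<open>Real powers of a base in \<open>[1,\<infinity>]\<close>, for a positive exponent (hence \<open>\<infinity>\<close> goes to \<open>\<infinity>\<close>).\<close>

definition ereal_powr :: "ereal \<Rightarrow> real \<Rightarrow> ereal" where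
  "ereal_powr x r = (if x = \<infinity> then \<infinity> else ereal (real_of_ereal x powr r))"

end

theory Submission imports Defs begin

text \<open>In logarithmic coordinates to base \<open>t\<close>, a sum of \<open>m\<close> positive terms differs from its largest
  term by at most \<open>log t m\<close>, so a relatively elementary function is within \<open>log t M\<close> of its
  (max,+)-function. Hence two tropically equivalent recursions, started at logarithmic distance
  \<open>b\<close>, are after one step at distance at most \<open>2 log t M + c b\<close>. Along the lattice these
  steps accumulate at the rate of the height \<open>i + j (\<gamma> + 1)\<close>: at \<open>(i, j)\<close> the step uses \<open>w\<close> at
  that height and \<open>z\<close> at indices \<open>(i + k, j)\<close> with \<open>k \<le> \<gamma>\<close>, which were produced in row
  \<open>j - 1\<close> at height at most \<open>i + j (\<gamma> + 1) - 1\<close>.\<close>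

section \<open>Lipschitz constants\<close>

lemma abs_vec_index_le_max_norm:
  assumes "i < dim_vec x"
  shows "\<bar>x $ i\<bar> \<le> max_norm x"
  unfolding max_norm_def using assms by (intro Max_ge) auto

lemma max_norm_le:
  assumes "dim_vec x > 0" and "\<And>i. i < dim_vec x \<Longrightarrow> \<bar>x $ i\<bar> \<le> b"
  shows "max_norm x \<le> b"
  unfolding max_norm_def using assms by (subst Max_le_iff) auto

lemma max_norm_nonneg:
  assumes "dim_vec x > 0"
  shows "0 \<le> max_norm x"
  using abs_vec_index_le_max_norm[OF assms] by linarith

text \<open>The l1 norm of the slope is dual to the maximum norm, so it bounds the growth of the
  linear part; the constant term cancels. A one-sided bound is enough, since x and y may be
  exchanged.\<close>

lemma affine_term_lipschitz:
  assumes a: "snd s \<in> carrier_vec n" and x: "x \<in> carrier_vec n" and y: "y \<in> carrier_vec n"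
  shows "affine_term s x - affine_term s y
    \<le> (\<Sum>i<n. \<bar>real_of_rat (snd s $ i)\<bar>) * max_norm (x - y)"
proof -
  have "affine_term s x - affine_term s y = (\<Sum>i<n. real_of_rat (snd s $ i) * (x - y) $ i)"
    using a x y
    by (auto simp: affine_term_def scalar_prod_def split_beta lessThan_atLeast0
        sum_subtractf[symmetric] algebra_simps intro!: sum.cong)
  also have "\<dots> \<le> (\<Sum>i<n. \<bar>real_of_rat (snd s $ i)\<bar> * max_norm (x - y))"
  proof (rule sum_mono)
    fix i assume "i \<in> {..<n}"
    then have "\<bar>(x - y) $ i\<bar> \<le> max_norm (x - y)"
      using y by (intro abs_vec_index_le_max_norm) auto
    then have "\<bar>real_of_rat (snd s $ i) * (x - y) $ i\<bar>
        \<le> \<bar>real_of_rat (snd s $ i)\<bar> * max_norm (x - y)"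
      unfolding abs_mult by (intro mult_left_mono) auto
    then show "real_of_rat (snd s $ i) * (x - y) $ i
        \<le> \<bar>real_of_rat (snd s $ i)\<bar> * max_norm (x - y)" by linarith
  qed
  finally show ?thesis by (simp add: sum_distrib_right)
qed

text \<open>A maximum inherits any constant common to all its terms. The sum of their nonnegative
  constants is one; only its existence matters here, not its sharpness.\<close>

lemma Max_affine_term_lipschitz:
  assumes n: "n > 0" and ne: "ss \<noteq> []" and carrier: "\<forall>s \<in> set ss. snd s \<in> carrier_vec n"
  obtains L where "0 \<le> L" and "\<And>x y. x \<in> carrier_vec n \<Longrightarrow> y \<in> carrier_vec n \<Longrightarrow>
    (MAX s \<in> set ss. affine_term s x) - (MAX s \<in> set ss. affine_term s y) \<le> L * max_norm (x - y)"
proof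
  define A where "A = (\<lambda>s :: real \<times> rat vec. \<Sum>i<n. \<bar>real_of_rat (snd s $ i)\<bar>)"
  define L where "L = (\<Sum>s \<in> set ss. A s)"
  have A: "0 \<le> A s" for s by (simp add: A_def sum_nonneg)
  show "0 \<le> L" by (simp add: L_def A sum_nonneg)
  fix x y :: "real vec" assume x: "x \<in> carrier_vec n" and y: "y \<in> carrier_vec n"
  have "affine_term s x \<le> (MAX s \<in> set ss. affine_term s y) + L * max_norm (x - y)"
    if s: "s \<in> set ss" for s
  proof -
    have "affine_term s x - affine_term s y \<le> A s * max_norm (x - y)"
      unfolding A_def using s carrier x y by (intro affine_term_lipschitz) auto
    also have "\<dots> \<le> L * max_norm (x - y)"
      unfolding L_def using s A n x y
      by (intro mult_right_mono max_norm_nonneg member_le_sum) auto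
    finally have "affine_term s x - affine_term s y \<le> L * max_norm (x - y)" .
    moreover have "affine_term s y \<le> (MAX s \<in> set ss. affine_term s y)"
      using s by (intro Max_ge) auto
    ultimately show ?thesis by linarith
  qed
  then have "(MAX s \<in> set ss. affine_term s x)
      \<le> (MAX s \<in> set ss. affine_term s y) + L * max_norm (x - y)"
    using ne by (subst Max_le_iff) auto
  then show "(MAX s \<in> set ss. affine_term s x) - (MAX s \<in> set ss. affine_term s y)
      \<le> L * max_norm (x - y)" by linarith
qed

lemma max_norm_minus_commute:
  assumes "x \<in> carrier_vec n" and "y \<in> carrier_vec n"
  shows "max_norm (x - y) = max_norm (y - x)"
  unfolding max_norm_def using assms
  by (intro arg_cong[of _ _ Max] image_cong) (auto simp: abs_minus_commute)

lemma maxplus_fun_lipschitz: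
  assumes n: "n > 0" and p: "relative_maxplus n p"
  obtains L where "0 \<le> L" and "\<forall>x \<in> carrier_vec n. \<forall>y \<in> carrier_vec n.
    \<bar>maxplus_fun p x - maxplus_fun p y\<bar> \<le> L * max_norm (x - y)"
proof -
  have ne: "pos_terms p \<noteq> []" "neg_terms p \<noteq> []"
    and carrier: "\<forall>s \<in> set (pos_terms p). snd s \<in> carrier_vec n"
      "\<forall>s \<in> set (neg_terms p). snd s \<in> carrier_vec n"
    using p by (auto simp: relative_maxplus_def)
  obtain K where K: "0 \<le> K" "\<And>x y. x \<in> carrier_vec n \<Longrightarrow> y \<in> carrier_vec n \<Longrightarrow>
    (MAX s \<in> set (pos_terms p). affine_term s x) - (MAX s \<in> set (pos_terms p). affine_term s y)
      \<le> K * max_norm (x - y)"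
    using Max_affine_term_lipschitz[OF n ne(1) carrier(1)] by blast
  obtain L where L: "0 \<le> L" "\<And>x y. x \<in> carrier_vec n \<Longrightarrow> y \<in> carrier_vec n \<Longrightarrow>
    (MAX s \<in> set (neg_terms p). affine_term s x) - (MAX s \<in> set (neg_terms p). affine_term s y)
      \<le> L * max_norm (x - y)"
    using Max_affine_term_lipschitz[OF n ne(2) carrier(2)] by blast
  show thesis
  proof
    show "0 \<le> K + L" using K(1) L(1) by simp
    show "\<forall>x \<in> carrier_vec n. \<forall>y \<in> carrier_vec n.
      \<bar>maxplus_fun p x - maxplus_fun p y\<bar> \<le> (K + L) * max_norm (x - y)"
    proof (intro ballI)
      fix x y :: "real vec" assume xy: "x \<in> carrier_vec n" "y \<in> carrier_vec n"
      show "\<bar>maxplus_fun p x - maxplus_fun p y\<bar> \<le> (K + L) * max_norm (x - y)"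
        \<comment> \<open>Using each one-sided bound in both orders of x and y gives the absolute
          value, because \<open>max_norm (x - y)\<close> is symmetric.\<close>
        using K(2)[OF xy] K(2)[OF xy(2,1)] L(2)[OF xy] L(2)[OF xy(2,1)]
        unfolding maxplus_fun_def max_norm_minus_commute[OF xy(2,1)] distrib_right abs_le_iff
        by linarith
    qed
  qed
qed

text \<open>This makes the infimum in \<open>lipschitz_constant\<close> meaningful: on the reals,
  \<open>Inf\<close> of an empty set carries no information.\<close>

lemma lipschitz_bounds_nonempty:
  assumes "n > 0" and "relative_maxplus n p"
  shows "{L. 0 \<le> L \<and> (\<forall>x \<in> carrier_vec n. \<forall>y \<in> carrier_vec n.
    \<bar>maxplus_fun p x - maxplus_fun p y\<bar> \<le> L * max_norm (x - y))} \<noteq> {}"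
    (is "?S \<noteq> {}")
proof -
  obtain L where "0 \<le> L" "\<forall>x \<in> carrier_vec n. \<forall>y \<in> carrier_vec n.
    \<bar>maxplus_fun p x - maxplus_fun p y\<bar> \<le> L * max_norm (x - y)"
    using maxplus_fun_lipschitz[OF assms] .
  then have "L \<in> ?S" by simp
  then show ?thesis by blast
qed

lemma lipschitz_constant_nonneg:
  assumes "n > 0" and "relative_maxplus n p"
  shows "0 \<le> lipschitz_constant n (maxplus_fun p)"
  unfolding lipschitz_constant_def
  by (rule cInf_greatest[OF lipschitz_bounds_nonempty[OF assms]]) simp

text \<open>The infimum of all Lipschitz bounds is itself one: for fixed x and y at positive
  distance, the difference quotient is a lower bound of that set, hence at most its infimum.\<close>

lemma lipschitz_constant_attained:
  assumes n: "n > 0" and p: "relative_maxplus n p"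
    and x: "x \<in> carrier_vec n" and y: "y \<in> carrier_vec n"
  shows "\<bar>maxplus_fun p x - maxplus_fun p y\<bar>
    \<le> lipschitz_constant n (maxplus_fun p) * max_norm (x - y)"
proof (cases "max_norm (x - y) = 0")
  \<comment> \<open>At distance zero no quotient can be formed, but any finite Lipschitz bound
    already forces the two values to agree.\<close>
  case True
  obtain L where "\<forall>x \<in> carrier_vec n. \<forall>y \<in> carrier_vec n.
    \<bar>maxplus_fun p x - maxplus_fun p y\<bar> \<le> L * max_norm (x - y)"
    using maxplus_fun_lipschitz[OF n p] .
  then have "\<bar>maxplus_fun p x - maxplus_fun p y\<bar> \<le> L * max_norm (x - y)" using x y by blast
  then show ?thesis by (simp add: True)
next
  case False
  then have pos: "0 < max_norm (x - y)" using max_norm_nonneg[of "x - y"] n y by simp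
  have "\<bar>maxplus_fun p x - maxplus_fun p y\<bar> / max_norm (x - y)
      \<le> lipschitz_constant n (maxplus_fun p)"
    unfolding lipschitz_constant_def
    using pos x y by (intro cInf_greatest[OF lipschitz_bounds_nonempty[OF n p]])
      (simp add: pos_divide_le_eq)
  then show ?thesis using pos by (simp add: pos_divide_le_eq)
qed

section \<open>Relatively elementary functions in logarithmic coordinates\<close>

text \<open>Writing every coordinate as \<open>t powr log t (z $ i)\<close> turns a monomial into
  the exponential of an affine form in the logarithms.\<close>

lemma elementary_term_eq_powr:
  assumes t: "t > 1" and z: "\<forall>i < dim_vec z. z $ i > 0"
    and a: "snd s \<in> carrier_vec (dim_vec z)"
  shows "elementary_term t s z = t powr affine_term s (map_vec (log t) z)"
proof -
  have "(\<Prod>i<dim_vec z. z $ i powr real_of_rat (snd s $ i))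
      = (\<Prod>i<dim_vec z. t powr (real_of_rat (snd s $ i) * log t (z $ i)))"
  proof (rule prod.cong[OF refl])
    fix i assume "i \<in> {..<dim_vec z}"
    then have "z $ i = t powr log t (z $ i)" using z t by simp
    then show "z $ i powr real_of_rat (snd s $ i) = t powr (real_of_rat (snd s $ i) * log t (z $ i))"
      by (metis powr_powr mult.commute)
  qed
  also have "\<dots> = t powr (\<Sum>i<dim_vec z. real_of_rat (snd s $ i) * log t (z $ i))"
    using t by (simp add: powr_sum)
  finally show ?thesis
    using a by (simp add: elementary_term_def affine_term_def split_beta scalar_prod_def powr_add
        lessThan_atLeast0)
qed

text \<open>The sum contains its largest term \<open>t powr m\<close> and is at most
  \<open>length xs\<close> copies of it. The list length is the right count, as repeated terms
  contribute repeatedly to the sum.\<close>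

lemma sum_list_powr_bounds:
  fixes h :: "'a \<Rightarrow> real"
  assumes t: "t > 1" and ne: "xs \<noteq> []"
  defines "m \<equiv> MAX s \<in> set xs. h s"
  shows "0 < (\<Sum>s\<leftarrow>xs. t powr h s)"
    and "m \<le> log t (\<Sum>s\<leftarrow>xs. t powr h s)"
    and "log t (\<Sum>s\<leftarrow>xs. t powr h s) \<le> log t (real (length xs)) + m"
proof -
  have "m \<in> h ` set xs" unfolding m_def using ne by (intro Max_in) auto
  then obtain s where s: "s \<in> set xs" "m = h s" by auto
  have ge: "t powr m \<le> (\<Sum>s\<leftarrow>xs. t powr h s)"
    unfolding s(2) using s(1) by (intro member_le_sum_list) auto
  then show pos: "0 < (\<Sum>s\<leftarrow>xs. t powr h s)" using t by (smt (verit) powr_gt_zero)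
  show "m \<le> log t (\<Sum>s\<leftarrow>xs. t powr h s)" using ge t pos by (simp add: le_log_iff)
  have "(\<Sum>s\<leftarrow>xs. t powr h s) \<le> (\<Sum>s\<leftarrow>xs. t powr m)"
    using t by (intro sum_list_mono powr_mono) (auto simp: m_def intro!: Max_ge)
  also have "\<dots> = real (length xs) * t powr m" by (simp add: sum_list_triv)
  finally have "log t (\<Sum>s\<leftarrow>xs. t powr h s) \<le> log t (real (length xs) * t powr m)"
    using t pos by (subst log_le_cancel_iff) auto
  also have "\<dots> = log t (real (length xs)) + m" using t ne by (simp add: log_mult)
  finally show "log t (\<Sum>s\<leftarrow>xs. t powr h s) \<le> log t (real (length xs)) + m" .
qed

lemma elementary_fun_eq_powr:
  assumes t: "t > 1" and z: "\<forall>i < dim_vec z. z $ i > 0"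
    and p: "relative_maxplus (dim_vec z) p"
  shows "elementary_fun t p z =
    (\<Sum>s\<leftarrow>pos_terms p. t powr affine_term s (map_vec (log t) z)) /
    (\<Sum>s\<leftarrow>neg_terms p. t powr affine_term s (map_vec (log t) z))"
proof -
  have "elementary_term t s z = t powr affine_term s (map_vec (log t) z)"
    if "s \<in> set (pos_terms p) \<union> set (neg_terms p)" for s
    using that p by (intro elementary_term_eq_powr t z) (auto simp: relative_maxplus_def split_beta)
  then have "map (\<lambda>s. elementary_term t s z) (pos_terms p)
      = map (\<lambda>s. t powr affine_term s (map_vec (log t) z)) (pos_terms p)"
    "map (\<lambda>s. elementary_term t s z) (neg_terms p)
      = map (\<lambda>s. t powr affine_term s (map_vec (log t) z)) (neg_terms p)"
    by auto
  then show ?thesis by (simp only: elementary_fun_def)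
qed

lemma elementary_fun_pos:
  assumes "t > 1" and "\<forall>i < dim_vec z. z $ i > 0" and "relative_maxplus (dim_vec z) p"
  shows "0 < elementary_fun t p z"
  using assms(3) unfolding elementary_fun_eq_powr[OF assms] relative_maxplus_def
  by (intro divide_pos_pos sum_list_powr_bounds(1) assms(1)) auto

lemma components_ge_1:
  assumes "relative_maxplus n p"
  shows "1 \<le> components p"
proof -
  have "0 < length (pos_terms p) * length (neg_terms p)"
    using assms by (simp add: relative_maxplus_def)
  then show ?thesis unfolding components_def by linarith
qed

text \<open>The logarithms of numerator and denominator exceed their maxima by at least 0 and at
  most the logarithms of the two lengths. Both errors together are bounded by the sum of these
  logarithms, which is the logarithm of the product \<open>components p\<close>.\<close>

lemma log_elementary_fun_approx:
  assumes t: "t > 1" and z: "\<forall>i < dim_vec z. z $ i > 0"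
    and p: "relative_maxplus (dim_vec z) p"
  shows "\<bar>log t (elementary_fun t p z) - maxplus_fun p (map_vec (log t) z)\<bar>
    \<le> log t (components p)"
proof -
  have ne: "pos_terms p \<noteq> []" "neg_terms p \<noteq> []" using p by (auto simp: relative_maxplus_def)
  have len: "0 \<le> log t (real (length (pos_terms p)))" "0 \<le> log t (real (length (neg_terms p)))"
    using t ne by (auto simp: Suc_le_eq zero_le_log_cancel_iff)
  have comp: "log t (components p)
      = log t (real (length (pos_terms p))) + log t (real (length (neg_terms p)))"
    using t ne by (simp add: components_def log_mult)
  let ?h = "\<lambda>s. affine_term s (map_vec (log t) z)"
  note pos = sum_list_powr_bounds[OF t ne(1), where h = ?h]
  note neg = sum_list_powr_bounds[OF t ne(2), where h = ?h]
  have "log t (elementary_fun t p z)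
      = log t (\<Sum>s\<leftarrow>pos_terms p. t powr ?h s) - log t (\<Sum>s\<leftarrow>neg_terms p. t powr ?h s)"
    unfolding elementary_fun_eq_powr[OF assms] using pos(1) neg(1) by (simp add: log_divide)
  then show ?thesis
    using pos(2,3) neg(2,3) len unfolding comp maxplus_fun_def abs_le_iff by linarith
qed

text \<open>Triangle inequality through the (max,+)-values at the logarithms of x and y: two
  approximation errors of at most \<open>log t M\<close> each, and one Lipschitz estimate in
  between.\<close>

lemma log_elementary_fun_diff:
  assumes t: "t > 1" and n: "n > 0"
    and p: "relative_maxplus n p" and q: "relative_maxplus n q"
    and equiv: "tropically_equivalent n p q"
    and lip: "lipschitz_constant n (maxplus_fun p) \<le> c"
    and M: "components p \<le> M" "components q \<le> M"
    and x: "x \<in> carrier_vec n" "\<And>i. i < n \<Longrightarrow> x $ i > 0"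
    and y: "y \<in> carrier_vec n" "\<And>i. i < n \<Longrightarrow> y $ i > 0"
    and b: "\<And>i. i < n \<Longrightarrow> \<bar>log t (x $ i) - log t (y $ i)\<bar> \<le> b"
  shows "\<bar>log t (elementary_fun t p x) - log t (elementary_fun t q y)\<bar> \<le> 2 * log t M + c * b"
proof -
  let ?X = "map_vec (log t) x" and ?Y = "map_vec (log t) y"
  have XY: "?X \<in> carrier_vec n" "?Y \<in> carrier_vec n" using x y by auto
  have dim: "dim_vec x = n" "dim_vec y = n" using x y by auto
  have "\<bar>maxplus_fun p ?X - maxplus_fun p ?Y\<bar>
      \<le> lipschitz_constant n (maxplus_fun p) * max_norm (?X - ?Y)"
    by (rule lipschitz_constant_attained[OF n p XY])
  also have "\<dots> \<le> c * b"
  proof (rule mult_mono[OF lip])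
    show "max_norm (?X - ?Y) \<le> b" using n b dim by (intro max_norm_le) auto
    show "0 \<le> c" using lipschitz_constant_nonneg[OF n p] lip by simp
    show "0 \<le> max_norm (?X - ?Y)" using n dim by (intro max_norm_nonneg) auto
  qed
  \<comment> \<open>Tropical equivalence replaces p by q at \<open>?Y\<close>, so the two
    presentations are compared through a single function on R^n.\<close>
  finally have "\<bar>maxplus_fun p ?X - maxplus_fun q ?Y\<bar> \<le> c * b"
    using equiv XY by (simp add: tropically_equivalent_def)
  moreover have "\<bar>log t (elementary_fun t p x) - maxplus_fun p ?X\<bar> \<le> log t (components p)"
    "\<bar>log t (elementary_fun t q y) - maxplus_fun q ?Y\<bar> \<le> log t (components q)"
    using p q x(2) y(2) by (auto simp: dim intro!: log_elementary_fun_approx t)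
  moreover have "log t (components p) \<le> log t M" "log t (components q) \<le> log t M"
    using t M components_ge_1[OF p] components_ge_1[OF q] by (auto intro!: log_mono)
  ultimately show ?thesis by (smt (verit))
qed

section \<open>The recursion on the lattice\<close>

text \<open>The exact solution of \<open>B (Suc n) = e + c * B n\<close> with \<open>B 0 = L\<close>
  would carry \<open>c ^ n * L\<close>. Replacing this power by \<open>c' ^ n\<close> with c' \<ge>
  1 keeps \<open>B\<close> a supersolution and makes it increasing even when c < 1. In the step
  hypotheses b is arbitrary, so that it can be taken as \<open>B\<close> at the height of the
  current point.\<close>

lemma lattice_recursion_bound:
  fixes u v :: "nat \<Rightarrow> nat \<Rightarrow> real" and e c c' L :: real and \<gamma> :: nat
  assumes e: "0 \<le> e" and c: "0 \<le> c" "c \<le> c'" "1 \<le> c'" and L: "0 \<le> L"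
    and u0: "\<And>i. u i 0 \<le> L" and v0: "\<And>j. v 0 j \<le> L"
    and u_step: "\<And>i j b. v i j \<le> b \<Longrightarrow> (\<And>k. k \<le> \<gamma> \<Longrightarrow> u (i + k) j \<le> b) \<Longrightarrow>
      u i (Suc j) \<le> e + c * b"
    and v_step: "\<And>i j b. v i j \<le> b \<Longrightarrow> (\<And>k. k \<le> \<gamma> \<Longrightarrow> u (i + k) j \<le> b) \<Longrightarrow>
      v (Suc i) j \<le> e + c * b"
  defines "B \<equiv> \<lambda>n. e * (\<Sum>l<n. c ^ l) + c' ^ n * L"
  shows "u i (Suc j) \<le> B (i + 1 + j * (\<gamma> + 1))" and "v i j \<le> B (i + j * (\<gamma> + 1))"
proof -
  have step: "e + c * B n \<le> B (Suc n)" for n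
  proof -
    have "c * (c' ^ n * L) \<le> c' * (c' ^ n * L)" using c L by (intro mult_right_mono) auto
    then show ?thesis
      unfolding B_def sum.lessThan_Suc_shift by (simp add: algebra_simps sum_distrib_left)
  qed
  have mono: "B m \<le> B n" if "m \<le> n" for m n
    unfolding B_def using that e c L
    by (intro add_mono mult_left_mono mult_right_mono sum_mono2 power_increasing) auto
  have L_le: "L \<le> B n" for n using mono[of 0 n] by (simp add: B_def)
  \<comment> \<open>If row j of u is under control, induction on i controls row j of v from its
    boundary value \<open>v 0 j\<close>, and both together control row \<open>Suc j\<close> of
    u.\<close>
  have row: "v i j \<le> B (i + j * (\<gamma> + 1)) \<and> u i (Suc j) \<le> B (i + 1 + j * (\<gamma> + 1))"
    if u: "\<And>i k. k \<le> \<gamma> \<Longrightarrow> u (i + k) j \<le> B (i + j * (\<gamma> + 1))" for i j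
  proof -
    have v: "v i j \<le> B (i + j * (\<gamma> + 1))" for i
    proof (induction i)
      case 0
      show ?case using v0[of j] L_le order_trans by blast
    next
      case (Suc i)
      have "v (Suc i) j \<le> e + c * B (i + j * (\<gamma> + 1))" using Suc u by (rule v_step)
      also have "\<dots> \<le> B (Suc (i + j * (\<gamma> + 1)))" by (rule step)
      finally show ?case by simp
    qed
    have "u i (Suc j) \<le> e + c * B (i + j * (\<gamma> + 1))" using v u by (rule u_step)
    also have "\<dots> \<le> B (Suc (i + j * (\<gamma> + 1)))" by (rule step)
    finally show ?thesis using v by simp
  qed
  have u: "u (i + k) j \<le> B (i + j * (\<gamma> + 1))" if "k \<le> \<gamma>" for i j k
    using that
  proof (induction j arbitrary: i k)
    case 0
    show ?case using u0 L_le order_trans by blast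
  next
    case (Suc j)
    \<comment> \<open>The value at column i + k has height larger by k, and k + 1 \<le> \<gamma> + 1
      is exactly what one more row adds to the height. This is why a row counts \<gamma> +
      1.\<close>
    have "u (i + k) (Suc j) \<le> B (i + k + 1 + j * (\<gamma> + 1))"
      using row[OF Suc.IH] by blast
    also have "\<dots> \<le> B (i + Suc j * (\<gamma> + 1))" using Suc.prems by (intro mono) simp
    finally show ?case .
  qed
  show "u i (Suc j) \<le> B (i + 1 + j * (\<gamma> + 1))" "v i j \<le> B (i + j * (\<gamma> + 1))"
    using row[OF u] by blast+
qed

lemma vCons_vec_index_prop:
  assumes "Q a" and "\<And>k. k \<le> n \<Longrightarrow> Q (f k)" and "i < n + 2"
  shows "Q (vCons a (vec (n + 1) f) $ i)"
  using assms by (cases i) auto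

text \<open>The dictionary between ratios and logarithmic distances: it converts the initial data
  into logarithmic form and the final bounds back.\<close>

lemma abs_log_diff_le_iff:
  fixes x y :: real
  assumes "t > 1" and "x > 0" and "y > 0"
  shows "\<bar>log t x - log t y\<bar> \<le> b \<longleftrightarrow> x / y \<le> t powr b \<and> y / x \<le> t powr b"
proof -
  have "log t x - log t y = log t (x / y)" "log t y - log t x = log t (y / x)"
    using assms by (simp_all add: log_divide)
  then have "\<bar>log t x - log t y\<bar> \<le> b \<longleftrightarrow> log t (x / y) \<le> b \<and> log t (y / x) \<le> b" by linarith
  then show ?thesis using assms by (simp add: log_le_iff)
qed

theorem proposition1p2:
  fixes \<alpha> \<beta> \<gamma> M :: nat
    and \<psi> \<phi> :: "nat \<Rightarrow> maxplus_pres"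
    and c c' t :: real
    and z0 w0 :: "nat \<Rightarrow> nat \<Rightarrow> real"
    and z w :: "nat \<Rightarrow> nat \<Rightarrow> nat \<Rightarrow> real"
    and \<Lambda> :: ereal
  assumes \<psi>: "\<And>l. l \<in> {1, 2} \<Longrightarrow> relative_maxplus (\<alpha> + 2) (\<psi> l)"
    and \<phi>: "\<And>l. l \<in> {1, 2} \<Longrightarrow> relative_maxplus (\<beta> + 2) (\<phi> l)"
    and equiv_f: "tropically_equivalent (\<alpha> + 2) (\<psi> 1) (\<psi> 2)"
    and equiv_g: "tropically_equivalent (\<beta> + 2) (\<phi> 1) (\<phi> 2)"
    and c: "c = Max {lipschitz_constant (\<alpha> + 2) (maxplus_fun (\<psi> 1)),
                     lipschitz_constant (\<alpha> + 2) (maxplus_fun (\<psi> 2)),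
                     lipschitz_constant (\<beta> + 2) (maxplus_fun (\<phi> 1)),
                     lipschitz_constant (\<beta> + 2) (maxplus_fun (\<phi> 2))}"
    and M: "M = Max {components (\<psi> 1), components (\<psi> 2), components (\<phi> 1), components (\<phi> 2)}"
    and \<gamma>: "\<gamma> = max \<alpha> \<beta>"
    and c': "c' = max c 1"
    and t: "t > 1"
    and z0_pos: "\<And>l i. l \<in> {1, 2} \<Longrightarrow> z0 l i > 0"
    and w0_pos: "\<And>l j. l \<in> {1, 2} \<Longrightarrow> w0 l j > 0"
    and z_init: "\<And>l i. l \<in> {1, 2} \<Longrightarrow> z l i 0 = z0 l i"
    and w_init: "\<And>l j. l \<in> {1, 2} \<Longrightarrow> w l 0 j = w0 l j"
    and z_step: "\<And>l i j. l \<in> {1, 2} \<Longrightarrow>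
      z l i (j + 1) = elementary_fun t (\<psi> l) (vCons (w l i j) (vec (\<alpha> + 1) (\<lambda>k. z l (i + k) j)))"
    and w_step: "\<And>l i j. l \<in> {1, 2} \<Longrightarrow>
      w l (i + 1) j = elementary_fun t (\<phi> l) (vCons (w l i j) (vec (\<beta> + 1) (\<lambda>k. z l (i + k) j)))"
    and \<Lambda>: "\<Lambda> = (SUP (i, j) \<in> UNIV.
      ereal (Max {z0 1 i / z0 2 i, z0 2 i / z0 1 i, w0 1 j / w0 2 j, w0 2 j / w0 1 j}))"
  shows "1 \<le> M \<and> 0 \<le> c \<and> 1 \<le> \<Lambda> \<and>
    (\<forall>i j. ereal (Max {z 1 i (j + 1) / z 2 i (j + 1), z 2 i (j + 1) / z 1 i (j + 1),
                        w 1 (i + 1) j / w 2 (i + 1) j, w 2 (i + 1) j / w 1 (i + 1) j})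
       \<le> ereal (real M powr (2 * P (i + j * (\<gamma> + 1)) c))
          * ereal_powr \<Lambda> (c' ^ (i + 1 + j * (\<gamma> + 1))))"
proof -

  \<comment> \<open>Bounds on the constants M, c and \<Lambda>\<close>
  have nat12: "(1::nat) \<in> {1, 2}" "(2::nat) \<in> {1, 2}" by simp_all
  have M_ge: "components (\<psi> 1) \<le> M" "components (\<psi> 2) \<le> M"
    "components (\<phi> 1) \<le> M" "components (\<phi> 2) \<le> M"
    unfolding M by (auto intro: Max_ge)
  have c_ge: "lipschitz_constant (\<alpha> + 2) (maxplus_fun (\<psi> 1)) \<le> c"
    "lipschitz_constant (\<beta> + 2) (maxplus_fun (\<phi> 1)) \<le> c"
    unfolding c by (auto intro: Max_ge)
  have M1: "1 \<le> M" using components_ge_1[OF \<psi>[OF nat12(1)]] M_ge(1) by simp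
  have c0: "0 \<le> c" using lipschitz_constant_nonneg[OF _ \<psi>[OF nat12(1)]] c_ge(1) by simp
  have init_le: "ereal (z0 1 i / z0 2 i) \<le> \<Lambda>" "ereal (z0 2 i / z0 1 i) \<le> \<Lambda>"
    "ereal (w0 1 j / w0 2 j) \<le> \<Lambda>" "ereal (w0 2 j / w0 1 j) \<le> \<Lambda>" for i j
    unfolding \<Lambda> by (auto simp: le_max_iff_disj intro!: SUP_upper2[of "(i, j)"])
  \<comment> \<open>Of two reciprocal positive ratios at least one is \<ge> 1; the index 0 serves as
    the witness.\<close>
  have \<Lambda>1: "1 \<le> \<Lambda>"
  proof (cases "z0 1 0 \<le> z0 2 0")
    case True
    then have "1 \<le> z0 2 0 / z0 1 0" using z0_pos[OF nat12(1)] by simp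
    then show ?thesis using init_le(2)[of 0] by (metis ereal_less_eq(3) one_ereal_def order_trans)
  next
    case False
    then have "1 \<le> z0 1 0 / z0 2 0" using z0_pos[OF nat12(2)] by simp
    then show ?thesis using init_le(1)[of 0] by (metis ereal_less_eq(3) one_ereal_def order_trans)
  qed

  \<comment> \<open>Positivity of the solutions\<close>
  define zv where "zv l i j = vCons (w l i j) (vec (\<alpha> + 1) (\<lambda>k. z l (i + k) j))" for l i j
  define wv where "wv l i j = vCons (w l i j) (vec (\<beta> + 1) (\<lambda>k. z l (i + k) j))" for l i j
  have dim: "dim_vec (zv l i j) = \<alpha> + 2" "dim_vec (wv l i j) = \<beta> + 2" for l i j
    by (simp_all add: zv_def wv_def)
  then have carrier: "zv l i j \<in> carrier_vec (\<alpha> + 2)" "wv l i j \<in> carrier_vec (\<beta> + 2)" for l i j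
    by (simp_all only: carrier_vecI)
  have step: "z l i (Suc j) = elementary_fun t (\<psi> l) (zv l i j)"
    "w l (Suc i) j = elementary_fun t (\<phi> l) (wv l i j)" if "l \<in> {1, 2}" for l i j
    using z_step[OF that, of i j] w_step[OF that, of i j] by (simp_all add: zv_def wv_def)
  have zv_pos: "zv l i j $ k > 0"
    if "w l i j > 0" "\<And>i. z l i j > 0" "k < \<alpha> + 2" for l i j k
    unfolding zv_def
    by (rule vCons_vec_index_prop[where Q = "\<lambda>x. 0 < x"]) (use that in auto)
  have wv_pos: "wv l i j $ k > 0"
    if "w l i j > 0" "\<And>i. z l i j > 0" "k < \<beta> + 2" for l i j k
    unfolding wv_def
    by (rule vCons_vec_index_prop[where Q = "\<lambda>x. 0 < x"]) (use that in auto)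
  \<comment> \<open>Positivity spreads in the order of the recursion: row j of z gives row j of w by
    induction on i, and then both give row j + 1 of z.\<close>
  have w_pos_row: "w l i j > 0" if l: "l \<in> {1, 2}" and z: "\<And>i. z l i j > 0" for l i j
  proof (induction i)
    case 0
    show ?case using l w_init w0_pos by simp
  next
    case (Suc i)
    show ?case unfolding step(2)[OF l]
      using \<phi>[OF l] wv_pos[OF Suc z] by (intro elementary_fun_pos t) (auto simp: dim)
  qed
  have z_pos: "z l i j > 0" if l: "l \<in> {1, 2}" for l i j
  proof (induction j arbitrary: i)
    case 0
    show ?case using l z_init z0_pos by simp
  next
    case (Suc j)
    show ?case unfolding step(1)[OF l]
      using \<psi>[OF l] zv_pos[OF w_pos_row[OF l Suc] Suc]
      by (intro elementary_fun_pos t) (auto simp: dim)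
  qed
  have w_pos: "w l i j > 0" if "l \<in> {1, 2}" for l i j
    using w_pos_row[OF that z_pos[OF that]] .

  \<comment> \<open>The estimate in logarithmic coordinates and the return to ratios\<close>
  have "ereal (Max {z 1 i (j + 1) / z 2 i (j + 1), z 2 i (j + 1) / z 1 i (j + 1),
                    w 1 (i + 1) j / w 2 (i + 1) j, w 2 (i + 1) j / w 1 (i + 1) j})
       \<le> ereal (real M powr (2 * P (i + j * (\<gamma> + 1)) c))
          * ereal_powr \<Lambda> (c' ^ (i + 1 + j * (\<gamma> + 1)))" (is "_ \<le> ?R") for i j
  proof (cases "\<Lambda> = \<infinity>")
    \<comment> \<open>The right side is \<infinity>: its first factor is nonzero because M \<ge> 1,
      so the product does not fall under the convention 0 * \<infinity> = 0.\<close>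
    case True
    then show ?thesis using M1 by (simp add: ereal_powr_def)
  next
    case False
    then obtain r where r: "\<Lambda> = ereal r" and r1: "1 \<le> r" using \<Lambda>1 by (cases \<Lambda>) auto
    define u where "u i j = \<bar>log t (z 1 i j) - log t (z 2 i j)\<bar>" for i j
    define v where "v i j = \<bar>log t (w 1 i j) - log t (w 2 i j)\<bar>" for i j
    define e where "e = 2 * log t M"
    define n where "n = i + j * (\<gamma> + 1)"
    let ?L = "log t r"
    have tr: "t powr ?L = r" using t r1 by simp
    have e0: "0 \<le> e" and L0: "0 \<le> ?L" using t M1 r1 by (simp_all add: e_def)
    have c'_ge: "c \<le> c'" "1 \<le> c'" by (simp_all add: c')
    have u0: "u i 0 \<le> ?L" for i
      unfolding u_def using init_le(1,2)[of i] t z0_pos[OF nat12(1), of i] z0_pos[OF nat12(2), of i]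
      by (simp add: abs_log_diff_le_iff tr r z_init)
    have v0: "v 0 j \<le> ?L" for j
      unfolding v_def using init_le(3,4)[of j] t w0_pos[OF nat12(1), of j] w0_pos[OF nat12(2), of j]
      by (simp add: abs_log_diff_le_iff tr r w_init)
    \<comment> \<open>The head of the vector is a w-value, controlled by v, and the tail consists of
      z-values, controlled by u. A window length d \<le> \<gamma> covers both \<alpha> and
      \<beta>.\<close>
    have close: "\<bar>log t (vCons (w 1 i j) (vec (d + 1) (\<lambda>k. z 1 (i + k) j)) $ k)
        - log t (vCons (w 2 i j) (vec (d + 1) (\<lambda>k. z 2 (i + k) j)) $ k)\<bar> \<le> b"
      if "v i j \<le> b" "\<And>k. k \<le> \<gamma> \<Longrightarrow> u (i + k) j \<le> b" "d \<le> \<gamma>" "k < d + 2" for i j b d k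
      using that by (cases k) (auto simp: u_def v_def)
    have u_step: "u i (Suc j) \<le> e + c * b"
      if vb: "v i j \<le> b" and ub: "\<And>k. k \<le> \<gamma> \<Longrightarrow> u (i + k) j \<le> b" for i j b
      unfolding u_def e_def step(1)[OF nat12(1)] step(1)[OF nat12(2)]
    proof (rule log_elementary_fun_diff[OF t _ \<psi>[OF nat12(1)] \<psi>[OF nat12(2)] equiv_f c_ge(1)
          M_ge(1,2) carrier(1) _ carrier(1)])
      fix k assume k: "k < \<alpha> + 2"
      show "zv 1 i j $ k > 0" "zv 2 i j $ k > 0" using k z_pos w_pos by (auto intro!: zv_pos)
      show "\<bar>log t (zv 1 i j $ k) - log t (zv 2 i j $ k)\<bar> \<le> b"
        unfolding zv_def by (rule close[OF vb ub _ k]) (simp_all add: \<gamma>)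
    qed simp
    have v_step: "v (Suc i) j \<le> e + c * b"
      if vb: "v i j \<le> b" and ub: "\<And>k. k \<le> \<gamma> \<Longrightarrow> u (i + k) j \<le> b" for i j b
      unfolding v_def e_def step(2)[OF nat12(1)] step(2)[OF nat12(2)]
    proof (rule log_elementary_fun_diff[OF t _ \<phi>[OF nat12(1)] \<phi>[OF nat12(2)] equiv_g c_ge(2)
          M_ge(3,4) carrier(2) _ carrier(2)])
      fix k assume k: "k < \<beta> + 2"
      show "wv 1 i j $ k > 0" "wv 2 i j $ k > 0" using k z_pos w_pos by (auto intro!: wv_pos)
      show "\<bar>log t (wv 1 i j $ k) - log t (wv 2 i j $ k)\<bar> \<le> b"
        unfolding wv_def by (rule close[OF vb ub _ k]) (simp_all add: \<gamma>)
    qed simp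
    \<comment> \<open>Both \<open>u i (Suc j)\<close> and \<open>v (i + 1) j\<close> are bounded at
      height n + 1. The geometric sum then has n + 1 terms, ending with \<open>c ^ n\<close>, and
      equals \<open>P n c\<close>, whereas the power of c' is n + 1.\<close>
    define B where "B = e * P n c + c' ^ Suc n * ?L"
    have B_eq: "e * (\<Sum>l<i + 1 + j * (\<gamma> + 1). c ^ l) + c' ^ (i + 1 + j * (\<gamma> + 1)) * ?L = B"
      by (simp add: B_def P_def n_def lessThan_Suc_atMost)
    have uB: "u i (Suc j) \<le> B"
      unfolding B_eq[symmetric]
      by (rule lattice_recursion_bound(1)[where v = v])
        (fact e0 c0 c'_ge L0 u0 v0 | rule u_step v_step, assumption, blast)+
    have vB: "v (i + 1) j \<le> B"
      unfolding B_eq[symmetric]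
      by (rule lattice_recursion_bound(2)[where u = u])
        (fact e0 c0 c'_ge L0 u0 v0 | rule u_step v_step, assumption, blast)+
    \<comment> \<open>Exponentiating turns the accumulated error \<open>2 * log t M * P n c\<close>
      into a power of M and the initial distance \<open>log t r\<close> into a power of r =
      \<Lambda>.\<close>
    have "t powr B = (t powr log t M) powr (2 * P n c) * (t powr ?L) powr (c' ^ Suc n)"
      by (simp add: B_def e_def powr_add powr_powr mult_ac)
    then have R: "?R = ereal (t powr B)"
      using t M1 r1 by (simp add: r ereal_powr_def n_def)
    show ?thesis
      unfolding R using uB vB t z_pos w_pos
      unfolding u_def v_def by (subst (asm) (1 2) abs_log_diff_le_iff) auto
  qed
  then show ?thesis using M1 c0 \<Lambda>1 by blast
qed

end
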